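(* Every randomized online algorithm for the general unbounded knapsack problem has unbounded competitive ratio in expectation; i.e., for every such algorithm and every $c>0$ there is an instance $I$ with $\mathrm{opt}(I)/\mathrm{gain}(I)>c$.
   Context: Online general unbounded knapsack problem: knapsack capacity $1$; an instance is a sequence of items $x_1,\dots,x_n$ ($n$ unknown to the algorithm), item $x_i$ having a size $s_i\in[0,1]$ and a value $v_i\ge0$. Items arrive one by one; upon arrival of $x_i$ the algorithm irrevocably chooses a number $k_i\in\mathbb{N}_0$ of copies to pack, with the total packed size never exceeding $1$. $\mathrm{opt}(I)=\max\{\sum_i k_i v_i: k_i\in\mathbb{N}_0,\sum_i k_i s_i\le1\}$. For a randomized algorithm, $\mathrm{gain}(I)$ is the expected total packed value, and the competitive ratio in expectation is $\sup_I \mathrm{opt}(I)/\mathrm{gain}(I)$. *)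

theory Defs
  imports "HOL-Probability.Probability"
begin

type_synonym item = "real \<times> real"  \<comment> \<open>(size, value)\<close>

definition is_instance :: "item list \<Rightarrow> bool" where
  "is_instance I \<longleftrightarrow> (\<forall>(s, v) \<in> set I. 0 \<le> s \<and> s \<le> 1 \<and> 0 \<le> v)"

text \<open>\<open>k i\<close> is the number of copies of the \<open>i\<close>-th item (counting from 0) that are packed.\<close>

definition packed_size :: "item list \<Rightarrow> (nat \<Rightarrow> nat) \<Rightarrow> real" where
  "packed_size I k = (\<Sum>i<length I. real (k i) * fst (I ! i))"

definition packed_value :: "item list \<Rightarrow> (nat \<Rightarrow> nat) \<Rightarrow> real" where
  "packed_value I k = (\<Sum>i<length I. real (k i) * snd (I ! i))"

definition packing_values :: "item list \<Rightarrow> real set" where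
  "packing_values I = {packed_value I k | k. packed_size I k \<le> 1}"

text \<open>
  The maximum defining the optimum fails to exist exactly when the instance contains an item
  of size 0 and positive value; \<open>has_opt\<close> singles out the instances where it does exist.
  Outside \<open>has_opt\<close>, the value of \<open>opt\<close> is unspecified.
\<close>

definition has_opt :: "item list \<Rightarrow> bool" where
  "has_opt I \<longleftrightarrow> (\<exists>x \<in> packing_values I. \<forall>y \<in> packing_values I. y \<le> x)"

definition opt :: "item list \<Rightarrow> real" where
  "opt I = (GREATEST x. x \<in> packing_values I)"

text \<open>
  A deterministic online algorithm \<open>a\<close> maps the nonempty sequence of items revealed so far to
  the number of copies packed of the last of these items. Its own earlier decisions are
  determined by this sequence, so they need not be a separate argument.
\<close>

type_synonym online_alg = "item list \<Rightarrow> nat"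

definition copies :: "online_alg \<Rightarrow> item list \<Rightarrow> nat \<Rightarrow> nat" where
  "copies a I i = a (take (Suc i) I)"

text \<open>
  A randomized online algorithm is a random deterministic one: \<open>A w\<close> is the algorithm run
  on the outcome \<open>w\<close> of an arbitrary probability space \<open>M\<close>. Prefixes of instances are
  instances, so the capacity is respected after every single step.
\<close>

definition randomized_online_alg :: "'w measure \<Rightarrow> ('w \<Rightarrow> online_alg) \<Rightarrow> bool" where
  "randomized_online_alg M A \<longleftrightarrow>
     prob_space M \<and>
     (\<forall>I. is_instance I \<longrightarrow> (\<lambda>w. A w I) \<in> M \<rightarrow>\<^sub>M count_space UNIV) \<and>
     (\<forall>w \<in> space M. \<forall>I. is_instance I \<longrightarrow> packed_size I (copies (A w) I) \<le> 1)"

definition gain :: "'w measure \<Rightarrow> ('w \<Rightarrow> online_alg) \<Rightarrow> item list \<Rightarrow> ennreal" where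
  "gain M A I = (\<integral>\<^sup>+ w. ennreal (packed_value I (copies (A w) I)) \<partial>M)"

text \<open>
  The ratio is taken in \<^typ>\<open>ennreal\<close>, where \<open>x / 0 = \<infinity>\<close> for \<open>x > 0\<close>, and \<open>0 / 0 = 0\<close>.
\<close>

definition ratio :: "'w measure \<Rightarrow> ('w \<Rightarrow> online_alg) \<Rightarrow> item list \<Rightarrow> ennreal" where
  "ratio M A I = ennreal (opt I) / gain M A I"

definition competitive_ratio :: "'w measure \<Rightarrow> ('w \<Rightarrow> online_alg) \<Rightarrow> ennreal" where
  "competitive_ratio M A = (SUP I \<in> {I. is_instance I \<and> has_opt I}. ratio M A I)"

end

theory Submission
  imports Defs
begin

text \<open>
  All items have size 1 and the \<open>j\<close>-th one has value \<open>N ^ j\<close>, so an algorithm packs at most one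
  item in total. Among the first \<open>N\<close> items some item \<open>i\<close> is packed with probability at most
  \<open>1 / N\<close>. If the instance stops right after it, the optimum is \<open>N ^ i\<close>, while packing item \<open>i\<close>
  contributes at most \<open>N ^ i / N\<close> to the gain, and so do all earlier items together.
\<close>

definition unit_items :: "nat \<Rightarrow> nat \<Rightarrow> item list" where
  "unit_items N n = map (\<lambda>j. (1, real N ^ j)) [0..<n]"

lemma is_instance_unit_items: "is_instance (unit_items N n)"
  by (auto simp: is_instance_def unit_items_def)

lemma packed_size_unit_items: "packed_size (unit_items N n) k = (\<Sum>j<n. real (k j))"
  by (simp add: packed_size_def unit_items_def)

lemma packed_value_unit_items:
  "packed_value (unit_items N n) k = (\<Sum>j<n. real (k j) * real N ^ j)"
  by (simp add: packed_value_def unit_items_def)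

text \<open>A prefix of \<open>unit_items N n\<close> is again a list of this family. Hence the
  decision on item \<open>j\<close> does not depend on where the instance stops.\<close>

lemma copies_unit_items:
  "j < n \<Longrightarrow> copies a (unit_items N n) j = a (unit_items N (Suc j))"
  by (simp add: copies_def unit_items_def take_map del: upt_Suc)

text \<open>The factor \<open>N\<close> raises each exponent \<open>j\<close> to
  \<open>Suc j \<le> n\<close>, and the weights sum to at most 1. With \<open>n = Suc i\<close> this
  bounds the optimum, with \<open>n = i\<close> the value of the items before item
  \<open>i\<close>.\<close>

lemma weighted_powers_le:
  fixes k :: "nat \<Rightarrow> nat" and N :: nat
  assumes "N \<ge> 1" "(\<Sum>j<n. real (k j)) \<le> 1"
  shows "real N * (\<Sum>j<n. real (k j) * real N ^ j) \<le> real N ^ n"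
proof -
  have "real N * (\<Sum>j<n. real (k j) * real N ^ j) = (\<Sum>j<n. real (k j) * real N ^ Suc j)"
    by (simp add: sum_distrib_left algebra_simps)
  also have "\<dots> \<le> (\<Sum>j<n. real (k j) * real N ^ n)"
    using assms(1) by (intro sum_mono mult_left_mono power_increasing) auto
  also have "\<dots> \<le> real N ^ n"
    using mult_right_mono[OF assms(2), of "real N ^ n"] by (simp add: sum_distrib_right)
  finally show ?thesis .
qed

lemma unit_items_greatest:
  assumes "N \<ge> 1"
  shows "real N ^ i \<in> packing_values (unit_items N (Suc i))"
    and "y \<in> packing_values (unit_items N (Suc i)) \<Longrightarrow> y \<le> real N ^ i"
proof -
  define k where "k = (\<lambda>j. if j = i then 1 else 0 :: nat)"
  have "packed_size (unit_items N (Suc i)) k = 1"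
    by (simp add: packed_size_unit_items k_def)
  moreover have "packed_value (unit_items N (Suc i)) k = real N ^ i"
    by (simp add: packed_value_unit_items k_def)
  ultimately show "real N ^ i \<in> packing_values (unit_items N (Suc i))"
    unfolding packing_values_def by (intro CollectI exI[of _ k]) simp
next
  assume "y \<in> packing_values (unit_items N (Suc i))"
  then obtain k where y: "y = (\<Sum>j<Suc i. real (k j) * real N ^ j)"
    and k: "(\<Sum>j<Suc i. real (k j)) \<le> 1"
    by (auto simp: packing_values_def packed_size_unit_items packed_value_unit_items)
  have "real N * y \<le> real N * real N ^ i"
    using weighted_powers_le[OF assms k] by (simp add: y)
  then show "y \<le> real N ^ i"
    using assms by simp
qed

lemma has_opt_unit_items: "N \<ge> 1 \<Longrightarrow> has_opt (unit_items N (Suc i))"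
  using unit_items_greatest unfolding has_opt_def by blast

lemma opt_unit_items: "N \<ge> 1 \<Longrightarrow> opt (unit_items N (Suc i)) = real N ^ i"
  unfolding opt_def by (intro Greatest_equality unit_items_greatest)

text \<open>Turns an upper bound on the gain into a lower bound on the ratio, including the case of
  gain 0.\<close>

lemma divide_left_mono_ennreal:
  fixes a b c :: ennreal
  assumes "a \<le> b"
  shows "c / b \<le> c / a"
proof -
  have "inverse b \<le> inverse a"
  \<comment> \<open>At these extremes \<open>inverse a\<close> is \<open>top\<close> or
    \<open>inverse b\<close> is 0; otherwise both are positive reals.\<close>
  proof (cases "a = 0 \<or> b = top")
    case False
    with assms obtain x y where "a = ennreal x" "b = ennreal y" "0 < x" "x \<le> y"
      by (cases a; cases b) (auto simp: top_unique less_le)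
    then show ?thesis
      by (simp add: inverse_ennreal)
  qed auto
  then show ?thesis
    by (simp add: divide_ennreal_def mult_left_mono)
qed

text \<open>The factor 2 collects two bounds of \<open>N ^ i / N\<close>: one for item
  \<open>i\<close> in expectation, one for all earlier items in every outcome.\<close>

lemma exists_small_gain:
  assumes A: "randomized_online_alg M A" and N: "N \<ge> 1"
  shows "\<exists>i<N. gain M A (unit_items N (Suc i)) \<le> ennreal (2 * real N ^ i / real N)"
proof -
  interpret prob_space M
    using A by (simp add: randomized_online_alg_def)
  define X where "X j w = A w (unit_items N (Suc j))" for j w
  have meas [measurable]: "(\<lambda>w. real (X j w)) \<in> borel_measurable M" for j
    using A is_instance_unit_items measurable_compose[of "X j" M "count_space UNIV" real borel]
    by (simp add: randomized_online_alg_def X_def[abs_def])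
  \<comment> \<open>Every stopping point \<open>n\<close> gives a legal instance, so the capacity
    bound holds for all \<open>n\<close> with the same variables \<open>X j\<close>.\<close>
  have sum_le: "(\<Sum>j<n. real (X j w)) \<le> 1" if "w \<in> space M" for n w
  proof -
    have "packed_size (unit_items N n) (copies (A w) (unit_items N n)) \<le> 1"
      using A that is_instance_unit_items by (simp add: randomized_online_alg_def)
    then show ?thesis
      by (simp add: packed_size_unit_items copies_unit_items X_def)
  qed
  have X_le: "real (X j w) \<le> 1" if "w \<in> space M" for j w
    using sum_le[OF that, of "Suc j"] sum_nonneg[of "{..<j}" "\<lambda>j. real (X j w)"] by simp
  have int: "integrable M (\<lambda>w. real (X j w))" for j
    by (rule integrable_const_bound[where B = 1]) (use X_le in auto)
  define p where "p j = expectation (\<lambda>w. real (X j w))" for j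
  have "(\<Sum>j<N. p j) = expectation (\<lambda>w. \<Sum>j<N. real (X j w))"
    by (simp add: p_def int)
  also have "\<dots> \<le> expectation (\<lambda>w. 1)"
    using int sum_le by (intro integral_mono) auto
  finally have p_sum: "(\<Sum>j<N. p j) \<le> 1"
    by (simp add: prob_space)
  \<comment> \<open>Averaging: \<open>N\<close> expectations with sum at most 1 cannot all exceed
    \<open>1 / N\<close>.\<close>
  have "\<exists>i<N. p i \<le> 1 / real N"
  proof (rule ccontr)
    assume "\<not> ?thesis"
    then have "(\<Sum>j<N. 1 / real N) < (\<Sum>j<N. p j)"
      using N by (intro sum_strict_mono) (auto simp: not_le lessThan_empty_iff)
    then show False
      using p_sum N by simp
  qed
  then obtain i where i: "i < N" "p i \<le> 1 / real N"
    by blast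
  \<comment> \<open>A pointwise bound on the packed value: the constant covers the items before
    \<open>i\<close>, the other term is item \<open>i\<close> itself.\<close>
  define Y where "Y w = real N ^ i / real N + real N ^ i * real (X i w)" for w
  have Y_int: "integrable M Y"
    unfolding Y_def using int by simp
  have "gain M A (unit_items N (Suc i)) \<le> (\<integral>\<^sup>+ w. ennreal (Y w) \<partial>M)"
    unfolding gain_def
  proof (intro nn_integral_mono ennreal_leI)
    fix w assume w: "w \<in> space M"
    have "(\<Sum>j<i. real (X j w) * real N ^ j) \<le> real N ^ i / real N"
      using weighted_powers_le[OF N sum_le[OF w]] N by (simp add: field_simps)
    then show "packed_value (unit_items N (Suc i)) (copies (A w) (unit_items N (Suc i))) \<le> Y w"
      by (simp add: packed_value_unit_items copies_unit_items X_def Y_def algebra_simps)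
  qed
  also have "\<dots> = ennreal (expectation Y)"
    by (rule nn_integral_eq_integral[OF Y_int]) (simp add: Y_def)
  also have "expectation Y = real N ^ i / real N + real N ^ i * p i"
    unfolding Y_def p_def using int by (simp add: prob_space)
  also have "ennreal \<dots> \<le> ennreal (2 * real N ^ i / real N)"
    using mult_left_mono[OF i(2), of "real N ^ i"] by (intro ennreal_leI) simp
  finally show ?thesis
    using i(1) by blast
qed

lemma exists_large_ratio:
  assumes A: "randomized_online_alg M A" and c: "c > 0"
  shows "\<exists>I. is_instance I \<and> has_opt I \<and> ratio M A I > ennreal c"
proof -
  \<comment> \<open>The gain bound makes the ratio at least
    \<open>N ^ i / (2 * N ^ i / N) = N / 2\<close>, which has to exceed \<open>c\<close>.\<close>
  obtain N :: nat where N: "real N > 2 * c"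
    using reals_Archimedean2 by blast
  then have N1: "N \<ge> 1"
    using c by (cases N) auto
  obtain i where gain: "gain M A (unit_items N (Suc i)) \<le> ennreal (2 * real N ^ i / real N)"
    using exists_small_gain[OF A N1] by blast
  have "ennreal c < ennreal (real N / 2)"
    using N c by (intro ennreal_lessI) auto
  also have "\<dots> = ennreal (real N ^ i) / ennreal (2 * real N ^ i / real N)"
    using N1 by (subst divide_ennreal) auto
  also have "\<dots> \<le> ratio M A (unit_items N (Suc i))"
    unfolding ratio_def opt_unit_items[OF N1] using gain by (rule divide_left_mono_ennreal)
  finally show ?thesis
    using is_instance_unit_items has_opt_unit_items[OF N1] by blast
qed

theorem theorem8:
  fixes M :: "'w measure" and A :: "'w \<Rightarrow> online_alg"
  assumes "randomized_online_alg M A"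
  shows "competitive_ratio M A = \<infinity> \<and>
    (\<forall>c::real. c > 0 \<longrightarrow> (\<exists>I. is_instance I \<and> has_opt I \<and> ratio M A I > ennreal c))"
proof
  show "\<forall>c::real. c > 0 \<longrightarrow> (\<exists>I. is_instance I \<and> has_opt I \<and> ratio M A I > ennreal c)"
    using exists_large_ratio[OF assms] by blast
  show "competitive_ratio M A = \<infinity>"
  proof (cases "competitive_ratio M A")
    case (real r)
    \<comment> \<open>The supremum \<open>r\<close> may be 0, whereas \<open>c\<close> must be
      positive; \<open>r + 1\<close> is positive and still above \<open>r\<close>.\<close>
    from real(1) have "r + 1 > 0"
      by simp
    then obtain I where I: "is_instance I" "has_opt I" "ennreal (r + 1) < ratio M A I"
      using exists_large_ratio[OF assms] by blast
    have "ratio M A I \<le> ennreal r"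
      unfolding real(2)[symmetric] competitive_ratio_def using I(1,2) by (intro SUP_upper) simp
    with I(3) have "ennreal (r + 1) < ennreal r"
      by (rule less_le_trans)
    then show ?thesis
      using real by (simp add: ennreal_less_iff)
  qed (simp add: top_ennreal_def)
qed

end
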